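(* For the game $\mathrm{CN}(4,2)$, the set of losing positions is $\mathcal{L}=\{(a,b,a,b)\mid a,b\ge 0\}$, where $a,b$ range over the non-negative integers.
   Context: For integers $1\le k\le n$, circular Nim $\mathrm{CN}(n,k)$ is the following two-player impartial game. A position is a vector $\mathbf p=(p_1,\ldots,p_n)$ of non-negative integers, the heights of $n$ stacks of tokens placed in a circle in this order (indices modulo $n$). A legal move consists of choosing $k$ cyclically consecutive stacks $i,i+1,\ldots,i+k-1$ (modulo $n$) and removing $a_j$ tokens, $0\le a_j\le p_j$, from each chosen stack $j$, with at least one token removed in total. Players alternate; a player who cannot move loses. A position is losing (belongs to $\mathcal{L}$) if the player about to move from it loses under optimal play by the opponent; equivalently, $\mathcal{L}$ is the set of positions none of whose options (positions reachable by one legal move) lies in $\mathcal{L}$. *)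

theory Defs
  imports Main
begin

text \<open>
  Circular Nim CN(n,k) for 1 \<le> k \<le> n. A position is the list of the n stack heights;
  stacks are indexed by 0, ..., n - 1 instead of 1, ..., n, with indices taken modulo n.
\<close>

definition cn_positions :: "nat \<Rightarrow> nat list set" where
  "cn_positions n = {p. length p = n}"

definition cn_window :: "nat \<Rightarrow> nat \<Rightarrow> nat \<Rightarrow> nat set" where
  "cn_window n k i = {(i + j) mod n | j. j < k}"

text \<open>Here a j is the number of tokens removed from the chosen stack j.\<close>

definition cn_move :: "nat \<Rightarrow> nat \<Rightarrow> nat list \<Rightarrow> nat list \<Rightarrow> bool" where
  "cn_move n k p q \<longleftrightarrow> p \<in> cn_positions n \<and>
     (\<exists>i<n. \<exists>a :: nat \<Rightarrow> nat.
        (\<forall>j \<in> cn_window n k i. a j \<le> p ! j) \<and>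
        (\<exists>j \<in> cn_window n k i. a j > 0) \<and>
        q = map (\<lambda>j. if j \<in> cn_window n k i then p ! j - a j else p ! j) [0..<n])"

lemma cn_move_sum_list:
  assumes "cn_move n k p q"
  shows "sum_list q < sum_list p"
proof -
  from assms obtain i a where len: "length p = n" and i: "i < n"
    and le: "\<forall>j \<in> cn_window n k i. a j \<le> p ! j"
    and ex: "\<exists>j \<in> cn_window n k i. a j > 0"
    and q: "q = map (\<lambda>j. if j \<in> cn_window n k i then p ! j - a j else p ! j) [0..<n]"
    unfolding cn_move_def cn_positions_def by blast
  from ex obtain j where j: "j \<in> cn_window n k i" "a j > 0" by blast
  have jn: "j < n" using j(1) i by (auto simp: cn_window_def)
  have "sum_list q = (\<Sum>l\<in>{0..<n}. q ! l)"
    by (simp add: sum_list_sum_nth q)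
  also have "\<dots> < (\<Sum>l\<in>{0..<n}. p ! l)"
  proof (rule sum_strict_mono_ex1)
    show "\<forall>l\<in>{0..<n}. q ! l \<le> p ! l" by (simp add: q)
    have "a j \<le> p ! j" using le j(1) by blast
    then have "q ! j < p ! j" using j jn by (simp add: q)
    then show "\<exists>l\<in>{0..<n}. q ! l < p ! l" using jn by auto
  qed simp
  also have "\<dots> = sum_list p" by (simp add: sum_list_sum_nth len)
  finally show ?thesis .
qed

text \<open>
  The recursion over the (well-founded) move relation makes a position losing iff none of
  its options is losing; in particular, a position without options is losing.
\<close>

function cn_losing :: "nat \<Rightarrow> nat \<Rightarrow> nat list \<Rightarrow> bool" where
  "cn_losing n k p \<longleftrightarrow> p \<in> cn_positions n \<and> (\<forall>q. cn_move n k p q \<longrightarrow> \<not> cn_losing n k q)"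
  by pat_completeness auto
termination
  by (relation "measure (\<lambda>(n, k, p). sum_list p)") (auto dest: cn_move_sum_list)

text \<open>The defining equation would loop as a rewrite rule.\<close>

declare cn_losing.simps [simp del]

definition cn_losing_set :: "nat \<Rightarrow> nat \<Rightarrow> nat list set" where
  "cn_losing_set n k = {p. cn_losing n k p}"

end

theory Submission
  imports Defs
begin

text \<open>
  Two adjacent stacks of a circle of four contain exactly one stack of each opposite pair.
  So a move between positions (a,b,a,b) leaves one stack of each pair unchanged and hence changes
  nothing, while from any other position one can lower the larger stack of each pair to the
  smaller one in a single move.
\<close>

text \<open>Eliminates the removal function: it can be recovered as \<open>p ! j - q ! j\<close>, so
  only the two positions and the window matter. Removing at least one token becomes
  \<open>q \<noteq> p\<close>.\<close>

lemma cn_move_iff: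
  "cn_move n k p q \<longleftrightarrow> length p = n \<and> length q = n \<and> q \<noteq> p \<and>
     (\<exists>i<n. \<forall>j<n. q ! j \<le> p ! j \<and> (j \<notin> cn_window n k i \<longrightarrow> q ! j = p ! j))"
    (is "?L \<longleftrightarrow> ?R")
proof
  assume L: ?L
  then obtain i a where "length p = n" "i < n"
    "q = map (\<lambda>j. if j \<in> cn_window n k i then p ! j - a j else p ! j) [0..<n]"
    unfolding cn_move_def cn_positions_def by blast
  moreover have "q \<noteq> p" using cn_move_sum_list[OF L] by auto
  ultimately show ?R by auto
next
  assume ?R
  then obtain i where len: "length p = n" "length q = n" and "q \<noteq> p" and i: "i < n"
    and q: "\<And>j. j < n \<Longrightarrow> q ! j \<le> p ! j \<and> (j \<notin> cn_window n k i \<longrightarrow> q ! j = p ! j)"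
    by blast
  \<comment> \<open>A stack where the positions differ must lie in the window, and it witnesses that
    a token is removed.\<close>
  then obtain l where l: "l < n" "q ! l \<noteq> p ! l" by (metis nth_equalityI)
  have "l \<in> cn_window n k i" "0 < p ! l - q ! l" using l q[of l] by auto
  then have "\<exists>j \<in> cn_window n k i. p ! j - q ! j > 0" by blast
  moreover have "q = map (\<lambda>j. if j \<in> cn_window n k i then p ! j - (p ! j - q ! j) else p ! j) [0..<n]"
    using len q by (intro nth_equalityI) auto
  ultimately show ?L
    unfolding cn_move_def cn_positions_def using len(1) i
    by (auto intro!: exI[of _ i] exI[of _ "\<lambda>j. p ! j - q ! j"])
qed

text \<open>Every move lowers the total number of tokens, so induction on this total shows that the
  two closure conditions leave only one candidate for the losing set.\<close>

lemma cn_losing_set_eqI: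
  assumes S: "S \<subseteq> cn_positions n"
    and stable: "\<And>p q. p \<in> S \<Longrightarrow> cn_move n k p q \<Longrightarrow> q \<notin> S"
    and absorbing: "\<And>p. p \<in> cn_positions n \<Longrightarrow> p \<notin> S \<Longrightarrow> \<exists>q\<in>S. cn_move n k p q"
  shows "cn_losing_set n k = S"
proof -
  have "cn_losing n k p \<longleftrightarrow> p \<in> S" for p
  proof (induction "sum_list p" arbitrary: p rule: less_induct)
    case less
    then have "cn_losing n k q \<longleftrightarrow> q \<in> S" if "cn_move n k p q" for q
      using cn_move_sum_list[OF that] by blast
    then have "cn_losing n k p \<longleftrightarrow> p \<in> cn_positions n \<and> (\<forall>q. cn_move n k p q \<longrightarrow> q \<notin> S)"
      by (subst cn_losing.simps) blast
    \<comment> \<open>For \<open>p\<close> in \<open>S\<close>, \<open>stable\<close> excludes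
      options in \<open>S\<close>; for a position outside \<open>S\<close>, \<open>absorbing\<close>
      supplies one.\<close>
    then show ?case using S stable absorbing by blast
  qed
  then show ?thesis by (auto simp: cn_losing_set_def)
qed

lemma cn_window_2: "cn_window n 2 i = {i mod n, Suc i mod n}"
proof -
  have "cn_window n 2 i = (\<lambda>j. (i + j) mod n) ` {..<2}"
    by (auto simp: cn_window_def)
  then show ?thesis by (simp add: numeral_2_eq_2 lessThan_Suc insert_commute)
qed

lemma ex_less_4: "(\<exists>i<4::nat. P i) \<longleftrightarrow> P 0 \<or> P 1 \<or> P 2 \<or> P 3"
  by (simp add: numeral_eq_Suc Ex_less_Suc2)

lemma all_less_4: "(\<forall>i<4::nat. P i) \<longleftrightarrow> P 0 \<and> P 1 \<and> P 2 \<and> P 3"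
  by (simp add: numeral_eq_Suc All_less_Suc2)

text \<open>The stacks outside a window are again two adjacent ones, and the four adjacent pairs are
  exactly the choices of one index from {0, 2} and one from {1, 3}. This turns the existence of a
  window into the two disjunctions.\<close>

lemma cn_move_4_2_iff:
  "cn_move 4 2 [a, b, c, d] [a', b', c', d'] \<longleftrightarrow>
     [a', b', c', d'] \<noteq> [a, b, c, d] \<and> a' \<le> a \<and> b' \<le> b \<and> c' \<le> c \<and> d' \<le> d \<and>
     (a' = a \<or> c' = c) \<and> (b' = b \<or> d' = d)"
  unfolding cn_move_iff ex_less_4 all_less_4 cn_window_2 by auto

theorem theorem2p2:
  shows "cn_losing_set 4 2 = {[a, b, a, b] | a b :: nat. True}"
proof (rule cn_losing_set_eqI)
  show "{[a, b, a, b] | a b :: nat. True} \<subseteq> cn_positions 4"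
    by (auto simp: cn_positions_def)
next
  fix p q :: "nat list"
  assume "p \<in> {[a, b, a, b] | a b. True}" "cn_move 4 2 p q"
  then show "q \<notin> {[a, b, a, b] | a b. True}"
    by (auto simp: cn_move_4_2_iff)
next
  fix p :: "nat list"
  assume p: "p \<in> cn_positions 4" "p \<notin> {[a, b, a, b] | a b. True}"
  then obtain a b c d where abcd: "p = [a, b, c, d]"
    by (auto simp: cn_positions_def numeral_eq_Suc length_Suc_conv)
  \<comment> \<open>A minimum keeps the smaller stack of each opposite pair, which gives both
    disjunctions. The result differs from \<open>p\<close> because \<open>p\<close> is not of the
    form \<open>[a, b, a, b]\<close>.\<close>
  have "cn_move 4 2 p [min a c, min b d, min a c, min b d]"
    using p(2) unfolding abcd cn_move_4_2_iff by (auto simp: min_def)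
  then show "\<exists>q\<in>{[a, b, a, b] | a b. True}. cn_move 4 2 p q" by blast
qed

end
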